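(* Let $\mathcal T$ be a complete theory of partial order. (a) If $\mathbb X$ is a model of $\mathcal T$ which is an FLD$_1$ partial order, then $\mathbb I(\mathbb Y)=\mathbb I(\mathbb X)$ for every model $\mathbb Y$ of $\mathcal T$. (b) $\mathcal T$ has a model which is an FLD$_1$ partial order iff all models of $\mathcal T$ are FLD$_1$ partial orders.
   Context: Lexicographic sum: for a partial order $\mathbb I=\langle I,\le_{\mathbb I}\rangle$ and partial orders $\mathbb X_i$ ($i\in I$) with pairwise disjoint domains, $\sum_{\mathbb I}\mathbb X_i$ is the partial order on $X=\bigcup_{i\in I}X_i$ in which $x\le x'$ iff either $x,x'\in X_i$ for some $i$ and $x\le_{\mathbb X_i}x'$, or $x\in X_i$, $x'\in X_j$ with $i<_{\mathbb I}j$. A partial order $\mathbb X$ is an FLD$_1$ partial order iff there are a finite partial order $\mathbb I$ and a partition $\{X_i:i\in I\}$ of $X$ such that $\mathbb X=\sum_{\mathbb I}\mathbb X_i$ (with $\mathbb X_i$ the induced suborder on $X_i$) and each $\mathbb X_i$ has a largest element; this is called an FLD$_1$ decomposition (an $\mathbb I$-decomposition) of $\mathbb X$. For an FLD$_1$ partial order $\mathbb X$, $\mathbb I(\mathbb X)$ is the class of finite partial orders $\mathbb I$ for which $\mathbb X$ has an FLD$_1$ decomposition $\mathbb X=\sum_{\mathbb I}\mathbb X_i$. *)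

theory Defs
  imports Main "HOL-Library.Disjoint_Sets"
begin

section \<open>First-order logic of one binary relation\<close>

text \<open>
  Formulas of the language with one binary relation symbol and equality.  The language has no
  function or constant symbols, so terms are just variables, in de Bruijn notation:
  \<^term>\<open>All p\<close> binds variable \<open>0\<close> of \<open>p\<close>, and variable \<open>Suc n\<close> of \<open>p\<close> is variable \<open>n\<close> outside.
\<close>

datatype fm =
    Bot
  | Eq nat nat
  | Le nat nat
  | Imp fm fm
  | All fm

definition Neg :: "fm \<Rightarrow> fm" where
  "Neg p = Imp p Bot"

primrec fv :: "fm \<Rightarrow> nat set" where
  "fv Bot = {}"
| "fv (Eq m n) = {m, n}"
| "fv (Le m n) = {m, n}"
| "fv (Imp p q) = fv p \<union> fv q"
| "fv (All p) = {n. Suc n \<in> fv p}"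

definition sentence :: "fm \<Rightarrow> bool" where
  "sentence p \<longleftrightarrow> fv p = {}"

text \<open>Capture-avoiding renaming of the free variables.\<close>

primrec rename :: "(nat \<Rightarrow> nat) \<Rightarrow> fm \<Rightarrow> fm" where
  "rename f Bot = Bot"
| "rename f (Eq m n) = Eq (f m) (f n)"
| "rename f (Le m n) = Le (f m) (f n)"
| "rename f (Imp p q) = Imp (rename f p) (rename f q)"
| "rename f (All p) = All (rename (case_nat 0 (\<lambda>n. Suc (f n))) p)"

text \<open>
  \<^term>\<open>inst p t\<close> substitutes the variable \<open>t\<close> for the variable that a quantifier in front of \<open>p\<close>
  would bind.
\<close>

definition inst :: "fm \<Rightarrow> nat \<Rightarrow> fm" where
  "inst p t = rename (case_nat t (\<lambda>n. n)) p"

text \<open>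
  Natural deduction for classical first-order logic with equality.  In \<open>AllI\<close> the assumptions are
  shifted, so that the generalized variable \<open>0\<close> does not occur in them.
\<close>

inductive proves :: "fm set \<Rightarrow> fm \<Rightarrow> bool" (infix "\<turnstile>" 50) where
  Assm: "p \<in> G \<Longrightarrow> G \<turnstile> p"
| ImpI: "insert p G \<turnstile> q \<Longrightarrow> G \<turnstile> Imp p q"
| ImpE: "G \<turnstile> Imp p q \<Longrightarrow> G \<turnstile> p \<Longrightarrow> G \<turnstile> q"
| Contr: "insert (Neg p) G \<turnstile> Bot \<Longrightarrow> G \<turnstile> p"
| AllI: "rename Suc ` G \<turnstile> p \<Longrightarrow> G \<turnstile> All p"
| AllE: "G \<turnstile> All p \<Longrightarrow> G \<turnstile> inst p t"
| EqRefl: "G \<turnstile> Eq t t"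
| EqSubst: "G \<turnstile> Eq s t \<Longrightarrow> G \<turnstile> inst p s \<Longrightarrow> G \<turnstile> inst p t"

definition complete_theory :: "fm set \<Rightarrow> bool" where
  "complete_theory T \<longleftrightarrow>
     (\<forall>p\<in>T. sentence p) \<and> \<not> T \<turnstile> Bot \<and> (\<forall>p. sentence p \<longrightarrow> T \<turnstile> p \<or> T \<turnstile> Neg p)"

definition po_axioms :: "fm set" where
  "po_axioms =
     {All (Le 0 0),
      All (All (Imp (Le 0 1) (Imp (Le 1 0) (Eq 0 1)))),
      All (All (All (Imp (Le 0 1) (Imp (Le 1 2) (Le 0 2)))))}"

definition complete_po_theory :: "fm set \<Rightarrow> bool" where
  "complete_po_theory T \<longleftrightarrow> complete_theory T \<and> (\<forall>p\<in>po_axioms. T \<turnstile> p)"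


section \<open>Structures and models\<close>

text \<open>A binary structure is a pair of a (nonempty) domain and a relation on it.\<close>

type_synonym 'a struct = "'a set \<times> 'a rel"

definition is_struct :: "'a struct \<Rightarrow> bool" where
  "is_struct X \<longleftrightarrow> fst X \<noteq> {} \<and> snd X \<subseteq> fst X \<times> fst X"

primrec sat :: "'a struct \<Rightarrow> (nat \<Rightarrow> 'a) \<Rightarrow> fm \<Rightarrow> bool" where
  "sat X e Bot \<longleftrightarrow> False"
| "sat X e (Eq m n) \<longleftrightarrow> e m = e n"
| "sat X e (Le m n) \<longleftrightarrow> (e m, e n) \<in> snd X"
| "sat X e (Imp p q) \<longleftrightarrow> (sat X e p \<longrightarrow> sat X e q)"
| "sat X e (All p) \<longleftrightarrow> (\<forall>a\<in>fst X. sat X (case_nat a e) p)"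

definition is_model :: "'a struct \<Rightarrow> fm set \<Rightarrow> bool" where
  "is_model X T \<longleftrightarrow> is_struct X \<and> (\<forall>p\<in>T. \<forall>e. range e \<subseteq> fst X \<longrightarrow> sat X e p)"


section \<open>Lexicographic sums and FLD1 partial orders\<close>

definition is_po :: "'a struct \<Rightarrow> bool" where
  "is_po X \<longleftrightarrow> partial_order_on (fst X) (snd X)"

definition suborder :: "'a struct \<Rightarrow> 'a set \<Rightarrow> 'a struct" where
  "suborder X A = (A, snd X \<inter> A \<times> A)"

definition lex_sum :: "'i struct \<Rightarrow> ('i \<Rightarrow> 'a struct) \<Rightarrow> 'a struct" where
  "lex_sum I X =
     ((\<Union>i\<in>fst I. fst (X i)),
      {(x, y). (\<exists>i\<in>fst I. x \<in> fst (X i) \<and> y \<in> fst (X i) \<and> (x, y) \<in> snd (X i)) \<or>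
               (\<exists>i\<in>fst I. \<exists>j\<in>fst I. (i, j) \<in> snd I \<and> i \<noteq> j \<and> x \<in> fst (X i) \<and> y \<in> fst (X j))})"

definition has_largest :: "'a struct \<Rightarrow> bool" where
  "has_largest X \<longleftrightarrow> (\<exists>m\<in>fst X. \<forall>x\<in>fst X. (x, m) \<in> snd X)"

definition fld1_decomposition :: "'a struct \<Rightarrow> 'i struct \<Rightarrow> ('i \<Rightarrow> 'a set) \<Rightarrow> bool" where
  "fld1_decomposition X I P \<longleftrightarrow>
     is_po I \<and> finite (fst I) \<and>
     (\<forall>i\<in>fst I. P i \<noteq> {}) \<and> disjoint_family_on P (fst I) \<and> (\<Union>i\<in>fst I. P i) = fst X \<and>
     X = lex_sum I (\<lambda>i. suborder X (P i)) \<and>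
     (\<forall>i\<in>fst I. has_largest (suborder X (P i)))"

text \<open>
  The class \<open>\<I>(X)\<close>, restricted to finite partial orders whose domain is a set of elements of the
  type \<open>'i\<close>; statements about the whole class are obtained by leaving \<open>'i\<close> arbitrary.
\<close>

definition fld1_indices :: "'a struct \<Rightarrow> 'i struct set" where
  "fld1_indices X = {I. \<exists>P. fld1_decomposition X I P}"

text \<open>
  HOL cannot quantify over the type of the index order inside a definition; as index orders are
  finite, those on sets of natural numbers suffice (lemma \<open>is_fld1_I\<close>).
\<close>

definition is_fld1 :: "'a struct \<Rightarrow> bool" where
  "is_fld1 X \<longleftrightarrow> is_po X \<and> (\<exists>(I :: nat struct) P. fld1_decomposition X I P)"

lemma is_fld1_I:
  fixes X :: "'a struct" and I :: "'i struct"
  assumes po: "is_po X" and dec: "fld1_decomposition X I P"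
  shows "is_fld1 X"
proof -
  obtain A r where I: "I = (A, r)" by (cases I)
  note d = dec[unfolded fld1_decomposition_def I fst_conv snd_conv]
  have "finite A" using d by simp
  then obtain g :: "'i \<Rightarrow> nat" where g: "inj_on g A"
    using finite_imp_inj_to_nat_seg by blast
  define h where "h = inv_into A g"
  have h: "h (g i) = i" if "i \<in> A" for i
    using that g by (simp add: h_def)
  have eqg: "g i = g j \<longleftrightarrow> i = j" if "i \<in> A" "j \<in> A" for i j
    using that g by (auto dest: inj_onD)
  define J where "J = (g ` A, map_prod g g ` r)"
  define Q where "Q = (\<lambda>n. P (h n))"
  have rA: "r \<subseteq> A \<times> A" and rr: "\<forall>i\<in>A. (i, i) \<in> r" and rt: "trans r" and ra: "antisym r"
    using d by (auto simp: is_po_def partial_order_on_def preorder_on_def refl_on_def)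
  have rel: "(g i, g j) \<in> snd J \<longleftrightarrow> (i, j) \<in> r" if "i \<in> A" "j \<in> A" for i j
  proof
    assume "(g i, g j) \<in> snd J"
    then obtain a b where ab: "(a, b) \<in> r" "g i = g a" "g j = g b"
      by (auto simp: J_def)
    then have "a \<in> A" "b \<in> A" using rA by auto
    then show "(i, j) \<in> r" using ab that eqg by simp
  next
    assume "(i, j) \<in> r"
    then show "(g i, g j) \<in> snd J" by (force simp: J_def)
  qed
  have "trans (snd J)"
  proof (rule transI)
    fix x y z assume xy: "(x, y) \<in> snd J" and yz: "(y, z) \<in> snd J"
    then obtain a b c where abc: "a \<in> A" "b \<in> A" "c \<in> A" "x = g a" "y = g b" "z = g c"
      using rA by (fastforce simp: J_def)
    then show "(x, z) \<in> snd J"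
      using xy yz rel rt by (metis transD)
  qed
  moreover have "antisym (snd J)"
  proof (rule antisymI)
    fix x y assume xy: "(x, y) \<in> snd J" and yx: "(y, x) \<in> snd J"
    then obtain a b where ab: "a \<in> A" "b \<in> A" "x = g a" "y = g b"
      using rA by (fastforce simp: J_def)
    then show "x = y"
      using xy yx rel ra by (metis antisymD)
  qed
  moreover have "snd J \<subseteq> fst J \<times> fst J" "refl_on (fst J) (snd J)"
    using rA rr by (force simp: J_def refl_on_def)+
  ultimately have "is_po J"
    by (simp add: is_po_def partial_order_on_def preorder_on_def)
  moreover have "finite (fst J)" using d by (simp add: J_def)
  moreover have "\<forall>n\<in>fst J. Q n \<noteq> {}" using d h by (auto simp: J_def Q_def)
  moreover have "disjoint_family_on Q (fst J)"
    using d by (simp add: J_def Q_def disjoint_family_on_def h) metis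
  moreover have "(\<Union>n\<in>fst J. Q n) = fst X" using d h by (auto simp: J_def Q_def)
  moreover have "lex_sum J (\<lambda>n. suborder X (Q n)) = lex_sum (A, r) (\<lambda>i. suborder X (P i))"
  proof -
    have fJ: "fst J = g ` A" by (simp add: J_def)
    have b1: "(\<exists>n\<in>fst J. F (h n)) \<longleftrightarrow> (\<exists>i\<in>A. F i)" for F
      by (simp add: fJ h)
    have b2: "(\<exists>m\<in>fst J. \<exists>n\<in>fst J. (m, n) \<in> snd J \<and> m \<noteq> n \<and> F (h m) (h n)) \<longleftrightarrow>
              (\<exists>i\<in>A. \<exists>j\<in>A. (i, j) \<in> r \<and> i \<noteq> j \<and> F i j)" for F
      by (simp add: fJ h rel eqg cong: bex_cong)
    have b3: "(\<Union>n\<in>fst J. Q n) = (\<Union>i\<in>A. P i)"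
      by (auto simp: fJ Q_def h)
    show ?thesis
      unfolding lex_sum_def suborder_def fst_conv snd_conv b3
      unfolding Q_def
      using b1[of "\<lambda>i. _ \<in> P i \<and> _ \<in> P i \<and> (_, _) \<in> snd X \<inter> P i \<times> P i"]
        b2[of "\<lambda>i j. _ \<in> P i \<and> _ \<in> P j"]
      by simp
  qed
  moreover have "\<forall>n\<in>fst J. has_largest (suborder X (Q n))"
    using d h by (auto simp: J_def Q_def)
  moreover have "X = lex_sum (A, r) (\<lambda>i. suborder X (P i))" using d by blast
  ultimately have "fld1_decomposition X J Q"
    unfolding fld1_decomposition_def by metis
  then show ?thesis
    using po unfolding is_fld1_def by blast
qed

end

theory Submission
  imports Defs "HOL-Library.Countable"
begin

text \<open>
  The parts of an FLD1 decomposition are definable from their largest elements, so for each finite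
  \<open>I\<close> the existence of an \<open>I\<close>-decomposition is a first-order sentence, which a complete theory
  decides.  This gives (a) and the forward direction of (b).  The backward direction of (b) would
  be vacuous if \<open>T\<close> had no model on the type \<open>'b\<close>; a Henkin construction shows that a consistent
  theory has a countable model, which is copied into any infinite type.
\<close>

section \<open>Renaming and soundness\<close>

text \<open>Completeness of \<open>T\<close> is stated through derivability, so two models, even on
  different types, agree on every sentence by soundness alone; the model existence theorem enters
  only in the backward direction of (b). There a model is needed on both types: one on
  \<open>'b\<close> to which the assumption applies, and one on \<open>'a\<close> to which the FLD1
  property is carried over. A finite type could not serve when all models of \<open>T\<close> are
  infinite, which is why (b) asks for infinite types. The two classes of index orders are compared
  member by member, each finite order having its own sentence.\<close>

abbreviation lift :: "(nat \<Rightarrow> nat) \<Rightarrow> nat \<Rightarrow> nat" where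
  "lift f \<equiv> case_nat 0 (\<lambda>n. Suc (f n))"

lemma rename_cong: "(\<And>n. n \<in> fv p \<Longrightarrow> f n = g n) \<Longrightarrow> rename f p = rename g p"
proof (induction p arbitrary: f g)
  case (All p)
  have "rename (lift f) p = rename (lift g) p"
    by (rule All.IH) (use All.prems in \<open>auto split: nat.split\<close>)
  then show ?case by simp
next
  case (Imp p q)
  have "rename f p = rename g p" "rename f q = rename g q"
    by (rule Imp.IH; use Imp.prems in simp)+
  then show ?case by simp
qed simp_all

lemma rename_rename: "rename f (rename g p) = rename (f \<circ> g) p"
proof (induction p arbitrary: f g)
  case (All p)
  have "lift f \<circ> lift g = lift (f \<circ> g)"
    by (auto split: nat.split)
  then show ?case by (simp only: rename.simps All)
qed auto

lemma rename_id: "rename (\<lambda>n. n) p = p"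
proof (induction p)
  case (All p)
  have "lift (\<lambda>n. n) = (\<lambda>n. n)" by (auto split: nat.split)
  then show ?case using All by simp
qed auto

lemma rename_inst: "rename f (inst p t) = inst (rename (lift f) p) (f t)"
proof -
  have "f \<circ> case_nat t (\<lambda>n. n) = case_nat (f t) (\<lambda>n. n) \<circ> lift f"
    by (auto split: nat.split)
  then show ?thesis by (simp add: inst_def rename_rename)
qed

lemma inst_rename_lift: "inst (rename (lift f) p) t = rename (case_nat t f) p"
proof -
  have "case_nat t (\<lambda>n. n) \<circ> lift f = case_nat t f"
    by (auto split: nat.split)
  then show ?thesis by (simp add: inst_def rename_rename)
qed

lemma finite_fv: "finite (fv p)"
proof (induction p)
  case (All p)
  have "fv (All p) = Suc -` fv p" by auto
  then show ?case using All by (simp add: finite_vimageI)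
qed auto

lemma sat_rename: "sat X e (rename f p) \<longleftrightarrow> sat X (e \<circ> f) p"
proof (induction p arbitrary: e f)
  case (All p)
  have "case_nat a e \<circ> lift f = case_nat a (e \<circ> f)" for a
    by (auto split: nat.split)
  then show ?case by (simp only: rename.simps sat.simps All)
qed auto

lemma sat_inst: "sat X e (inst p t) \<longleftrightarrow> sat X (case_nat (e t) e) p"
proof -
  have "e \<circ> case_nat t (\<lambda>n. n) = case_nat (e t) e"
    by (auto split: nat.split)
  then show ?thesis by (simp add: inst_def sat_rename)
qed

lemma sat_Neg [simp]: "sat X e (Neg p) \<longleftrightarrow> \<not> sat X e p"
  by (simp add: Neg_def)

lemma soundness:
  assumes "G \<turnstile> p" "range e \<subseteq> fst X" "\<And>q. q \<in> G \<Longrightarrow> sat X e q"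
  shows "sat X e p"
  using assms
proof (induction arbitrary: e)
  case (AllI G p)
  show ?case unfolding sat.simps
  proof
    fix a assume a: "a \<in> fst X"
    \<comment> \<open>The assumptions of \<open>AllI\<close> are shifted by \<open>Suc\<close>, so
      the value \<open>a\<close> given to variable 0 does not affect them.\<close>
    have "case_nat a e \<circ> Suc = e" by auto
    moreover have "range (case_nat a e) \<subseteq> fst X"
      using a AllI.prems(1) by (force split: nat.split)
    ultimately show "sat X (case_nat a e) p"
      using AllI.prems(2) by (intro AllI.IH) (auto simp: sat_rename)
  qed
next
  case (AllE G p t)
  then have "sat X e (All p)" by blast
  then show ?case using AllE.prems(1) by (auto simp: sat_inst)
next
  case (EqSubst G s t p)
  then have "sat X e (Eq s t)" "sat X e (inst p s)" by blast+
  then show ?case by (simp add: sat_inst)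
next
  case (ImpI p G q)
  then show ?case by (metis insert_iff sat.simps(4))
next
  case (Contr p G)
  then show ?case by (metis insert_iff sat.simps(1) sat_Neg)
next
  case (ImpE G p q)
  then show ?case by (metis sat.simps(4))
qed auto

lemma soundness_model:
  assumes "T \<turnstile> p" "is_model X T" "range e \<subseteq> fst X"
  shows "sat X e p"
  using soundness[OF assms(1,3)] assms(2,3) by (auto simp: is_model_def)

section \<open>Completeness\<close>

lemma proves_weaken: "G \<turnstile> p \<Longrightarrow> G \<subseteq> H \<Longrightarrow> H \<turnstile> p"
proof (induction arbitrary: H rule: proves.induct)
  case (ImpI p G q)
  then show ?case by (meson insert_mono proves.ImpI)
next
  case (Contr p G)
  then show ?case by (meson insert_mono proves.Contr)
next
  case (AllI G p)
  then show ?case by (meson image_mono proves.AllI)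
next
  case (ImpE G p q)
  then show ?case using proves.ImpE[of H p q] by simp
next
  case (AllE G p t)
  then show ?case using proves.AllE[of H p t] by simp
next
  case (EqSubst G s t p)
  then show ?case using proves.EqSubst[of H s t p] by simp
qed (auto intro: proves.Assm proves.EqRefl)

lemma proves_rename: "G \<turnstile> p \<Longrightarrow> rename f ` G \<turnstile> rename f p"
proof (induction arbitrary: f rule: proves.induct)
  case (ImpI p G q)
  then show ?case by (simp add: proves.ImpI)
next
  case (ImpE G p q)
  then show ?case by (metis proves.ImpE rename.simps(4))
next
  case (Contr p G)
  then show ?case by (metis Neg_def image_insert proves.Contr rename.simps(1,4))
next
  case (AllI G p)
  have "lift f \<circ> Suc = Suc \<circ> f" by auto
  then have "rename (lift f) ` rename Suc ` G = rename Suc ` rename f ` G"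
    by (simp add: image_image rename_rename)
  then show ?case using AllI.IH[of "lift f"] by (simp add: proves.AllI)
next
  case (AllE G p t)
  then show ?case by (metis proves.AllE rename.simps(5) rename_inst)
next
  case (EqSubst G s t p)
  then show ?case by (metis proves.EqSubst rename.simps(2) rename_inst)
qed (auto intro: proves.Assm proves.EqRefl)

lemma proves_finite: "G \<turnstile> p \<Longrightarrow> \<exists>F. finite F \<and> F \<subseteq> G \<and> F \<turnstile> p"
proof (induction rule: proves.induct)
  case (Assm p G)
  then show ?case by (intro exI[of _ "{p}"]) (auto intro: proves.Assm)
next
  case (ImpI p G q)
  then obtain F where F: "finite F" "F \<subseteq> insert p G" "F \<turnstile> q" by blast
  then have "insert p (F - {p}) \<turnstile> q" by (auto intro: proves_weaken)
  then show ?case using F by (intro exI[of _ "F - {p}"]) (auto intro: proves.ImpI)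
next
  case (Contr p G)
  then obtain F where F: "finite F" "F \<subseteq> insert (Neg p) G" "F \<turnstile> Bot" by blast
  then have "insert (Neg p) (F - {Neg p}) \<turnstile> Bot" by (auto intro: proves_weaken)
  then show ?case using F by (intro exI[of _ "F - {Neg p}"]) (auto intro: proves.Contr)
next
  case (ImpE G p q)
  then obtain F F' where "finite F" "F \<subseteq> G" "F \<turnstile> Imp p q" "finite F'" "F' \<subseteq> G" "F' \<turnstile> p"
    by blast
  moreover from this have "F \<union> F' \<turnstile> Imp p q" "F \<union> F' \<turnstile> p"
    by (auto intro: proves_weaken)
  ultimately show ?case by (intro exI[of _ "F \<union> F'"]) (auto intro: proves.ImpE)
next
  case (EqSubst G s t p)
  then obtain F F' where "finite F" "F \<subseteq> G" "F \<turnstile> Eq s t" "finite F'" "F' \<subseteq> G" "F' \<turnstile> inst p s"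
    by blast
  moreover from this have "F \<union> F' \<turnstile> Eq s t" "F \<union> F' \<turnstile> inst p s"
    by (auto intro: proves_weaken)
  ultimately show ?case by (intro exI[of _ "F \<union> F'"]) (auto intro: proves.EqSubst)
next
  case (AllI G p)
  then obtain F where "finite F" "F \<subseteq> rename Suc ` G" "F \<turnstile> p" by blast
  then show ?case by (metis finite_subset_image proves.AllI)
next
  case (EqRefl G t)
  show ?case by (intro exI[of _ "{}"]) (simp add: proves.EqRefl)
qed (blast intro: proves.AllE)

lemma proves_NegE: "G \<turnstile> Neg p \<Longrightarrow> G \<turnstile> p \<Longrightarrow> G \<turnstile> Bot"
  unfolding Neg_def by (rule proves.ImpE)

text \<open>Generalization over a named variable instead of the de Bruijn variable 0. The renaming
  \<open>f\<close> sends \<open>t\<close> to 0 and shifts every other variable: on \<open>G\<close>,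
  where \<open>t\<close> does not occur, it acts as \<open>Suc\<close>, and it turns
  \<open>inst q t\<close> back into \<open>q\<close>, so that \<open>AllI\<close> applies.\<close>

lemma proves_All_fresh:
  assumes "G \<turnstile> inst q t" "\<And>p. p \<in> G \<Longrightarrow> t \<notin> fv p" "t \<notin> fv (All q)"
  shows "G \<turnstile> All q"
proof -
  define f where "f = (\<lambda>n. if n = t then 0 else Suc n)"
  have "rename f p = rename Suc p" if "p \<in> G" for p
    using that assms(2) by (intro rename_cong) (auto simp: f_def)
  then have "rename f ` G = rename Suc ` G" by simp
  moreover have "rename f (inst q t) = rename (\<lambda>n. n) q"
    unfolding inst_def rename_rename
    by (rule rename_cong) (use assms(3) in \<open>auto simp: f_def split: nat.split\<close>)
  ultimately show ?thesis
    using proves_rename[OF assms(1), of f] by (simp add: rename_id proves.AllI)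
qed

text \<open>If the counterexample named by \<open>t\<close> were contradictory, then
  \<open>inst q t\<close> would be derivable and, \<open>t\<close> being fresh, so would
  \<open>All q\<close>, against \<open>Neg (All q)\<close> in \<open>G\<close>.\<close>

lemma consistent_witness:
  assumes "\<not> G \<turnstile> Bot" "Neg (All q) \<in> G" "\<And>p. p \<in> G \<Longrightarrow> t \<notin> fv p"
  shows "\<not> insert (Neg (inst q t)) G \<turnstile> Bot"
proof
  assume "insert (Neg (inst q t)) G \<turnstile> Bot"
  then have "G \<turnstile> inst q t" by (rule proves.Contr)
  moreover have "t \<notin> fv (All q)" using assms(2,3) by (fastforce simp: Neg_def)
  ultimately have "G \<turnstile> All q" using proves_All_fresh assms(3) by blast
  then show False using assms(1,2) proves.Assm proves_NegE by blast
qed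

section \<open>Henkin extension of a consistent set of sentences\<close>

instance fm :: countable
  by countable_datatype

text \<open>
  Since \<open>T\<close> consists of sentences, the variables themselves serve as Henkin constants: at each
  stage only finitely many of them have been used.
\<close>

definition fresh_var :: "fm set \<Rightarrow> nat" where
  "fresh_var G = (SOME t. \<forall>p\<in>G. t \<notin> fv p)"

text \<open>The variable must be fresh for \<open>p\<close> too, since \<open>p\<close> enters the
  set at the same step.\<close>

definition witnesses :: "fm set \<Rightarrow> fm \<Rightarrow> fm set" where
  "witnesses G p = {Neg (inst q (fresh_var (insert p G))) |q. p = Neg (All q)}"

definition henkin_step :: "fm set \<Rightarrow> fm \<Rightarrow> fm set" where
  "henkin_step G p = (if insert p G \<turnstile> Bot then G else insert p G \<union> witnesses G p)"

primrec henkin :: "fm set \<Rightarrow> nat \<Rightarrow> fm set" where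
  "henkin T 0 = T"
| "henkin T (Suc n) = henkin_step (henkin T n) (from_nat n)"

definition henkin_limit :: "fm set \<Rightarrow> fm set" where
  "henkin_limit T = (\<Union>n. henkin T n)"

lemma witnesses_cases:
  obtains "witnesses G p = {}"
  | q where "p = Neg (All q)" "witnesses G p = {Neg (inst q (fresh_var (insert p G)))}"
  by (cases "\<exists>q. p = Neg (All q)") (auto simp: witnesses_def Neg_def)

text \<open>\<open>T\<close> may be infinite, but its sentences contribute no variables, and each
  step adds at most two formulas. Hence a fresh variable is always left.\<close>

lemma finite_fv_henkin:
  assumes "\<And>p. p \<in> T \<Longrightarrow> sentence p"
  shows "finite (\<Union>p\<in>henkin T n. fv p)"
proof (induction n)
  case 0
  then show ?case using assms by (simp add: sentence_def)
next
  case (Suc n)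
  have "finite (witnesses G p)" for G p
    by (rule witnesses_cases[of G p]) auto
  then show ?case using Suc by (simp add: henkin_step_def finite_fv)
qed

lemma fresh_var_henkin:
  assumes "\<And>p. p \<in> T \<Longrightarrow> sentence p" "p \<in> insert q (henkin T n)"
  shows "fresh_var (insert q (henkin T n)) \<notin> fv p"
proof -
  let ?V = "\<Union>p\<in>insert q (henkin T n). fv p"
  have "finite ?V" using finite_fv_henkin[OF assms(1)] by (simp add: finite_fv)
  then obtain t where "t \<notin> ?V" by (meson ex_new_if_finite infinite_UNIV_nat)
  then have "\<forall>p\<in>insert q (henkin T n). t \<notin> fv p" by blast
  then show ?thesis unfolding fresh_var_def
    using someI[of "\<lambda>t. \<forall>p\<in>insert q (henkin T n). t \<notin> fv p"] assms(2) by blast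
qed

lemma henkin_consistent:
  assumes "\<And>p. p \<in> T \<Longrightarrow> sentence p" "\<not> T \<turnstile> Bot"
  shows "\<not> henkin T n \<turnstile> Bot"
proof (induction n)
  case 0
  then show ?case using assms by simp
next
  case (Suc n)
  let ?p = "from_nat n :: fm"
  show ?case
  proof (cases "insert ?p (henkin T n) \<turnstile> Bot")
    case True
    then show ?thesis using Suc by (simp add: henkin_step_def)
  next
    case False
    show ?thesis
    proof (rule witnesses_cases[of "henkin T n" ?p])
      assume "witnesses (henkin T n) ?p = {}"
      then show ?thesis using False by (simp add: henkin_step_def)
    next
      fix q assume q: "?p = Neg (All q)"
        "witnesses (henkin T n) ?p = {Neg (inst q (fresh_var (insert ?p (henkin T n))))}"
      have "\<not> insert (Neg (inst q (fresh_var (insert ?p (henkin T n)))))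
          (insert ?p (henkin T n)) \<turnstile> Bot"
        using False q(1) fresh_var_henkin[OF assms(1)] by (intro consistent_witness) auto
      then show ?thesis using False q(2) by (simp add: henkin_step_def)
    qed
  qed
qed

lemma henkin_mono: "m \<le> n \<Longrightarrow> henkin T m \<subseteq> henkin T n"
  by (rule lift_Suc_mono_le) (auto simp: henkin_step_def)

lemma henkin_limit_consistent:
  assumes "\<And>p. p \<in> T \<Longrightarrow> sentence p" "\<not> T \<turnstile> Bot"
  shows "\<not> henkin_limit T \<turnstile> Bot"
proof
  assume "henkin_limit T \<turnstile> Bot"
  then obtain F where F: "finite F" "F \<subseteq> henkin_limit T" "F \<turnstile> Bot"
    using proves_finite by blast
  have "\<exists>n. F \<subseteq> henkin T n"
    using F(1,2)
  proof (induction F)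
    case (insert p F)
    then obtain m n where "F \<subseteq> henkin T m" "p \<in> henkin T n"
      by (auto simp: henkin_limit_def)
    then have "insert p F \<subseteq> henkin T (max m n)"
      using henkin_mono[of m "max m n" T] henkin_mono[of n "max m n" T] by auto
    then show ?case by blast
  qed auto
  then show False using F(3) henkin_consistent[OF assms] proves_weaken by blast
qed

text \<open>Stage \<open>to_nat p\<close> decides \<open>p\<close>: a rejected formula leaves a
  derivation of its negation, an accepted one comes with its witness. Completeness is thus obtained
  for derivability, the form used for the term model.\<close>

lemma henkin_limit_cases:
  obtains "henkin_limit T \<turnstile> Neg p"
  | "p \<in> henkin_limit T" "\<And>q. p = Neg (All q) \<Longrightarrow> \<exists>t. Neg (inst q t) \<in> henkin_limit T"
proof (cases "insert p (henkin T (to_nat p)) \<turnstile> Bot")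
  case True
  then have "henkin T (to_nat p) \<turnstile> Neg p"
    by (simp add: Neg_def proves.ImpI)
  moreover have "henkin T (to_nat p) \<subseteq> henkin_limit T"
    unfolding henkin_limit_def by blast
  ultimately show ?thesis using that(1) proves_weaken by blast
next
  case False
  then have "henkin T (Suc (to_nat p)) =
      insert p (henkin T (to_nat p)) \<union> witnesses (henkin T (to_nat p)) p"
    by (simp add: henkin_step_def)
  moreover have "henkin T (Suc (to_nat p)) \<subseteq> henkin_limit T"
    unfolding henkin_limit_def by blast
  ultimately show ?thesis using that(2) by (auto simp: witnesses_def)
qed

section \<open>Term model and truth lemma\<close>

definition eq_rep :: "fm set \<Rightarrow> nat \<Rightarrow> nat" where
  "eq_rep S n = (LEAST m. S \<turnstile> Eq n m)"

text \<open>Least representatives stand in for the classes of provably equal variables, which keeps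
  the model on type \<open>nat\<close>.\<close>

definition term_model :: "fm set \<Rightarrow> nat struct" where
  "term_model S = (range (eq_rep S), {(eq_rep S m, eq_rep S n) |m n. S \<turnstile> Le m n})"

text \<open>In the template \<open>Eq 0 (Suc s)\<close> variable 0 marks the place to be replaced,
  and \<open>inst\<close> lowers \<open>Suc s\<close> back to \<open>s\<close>. The next two lemmas
  use templates of the same kind.\<close>

lemma proves_Eq_sym: "S \<turnstile> Eq s t \<Longrightarrow> S \<turnstile> Eq t s"
  using proves.EqSubst[of S s t "Eq 0 (Suc s)"] by (simp add: inst_def proves.EqRefl)

lemma proves_Eq_trans: "S \<turnstile> Eq s t \<Longrightarrow> S \<turnstile> Eq t u \<Longrightarrow> S \<turnstile> Eq s u"
  using proves.EqSubst[of S t u "Eq (Suc s) 0"] by (simp add: inst_def)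

lemma proves_Le_cong: "S \<turnstile> Eq s s' \<Longrightarrow> S \<turnstile> Eq t t' \<Longrightarrow> S \<turnstile> Le s t \<Longrightarrow> S \<turnstile> Le s' t'"
  using proves.EqSubst[of S s s' "Le 0 (Suc t)"] proves.EqSubst[of S t t' "Le (Suc s') 0"]
  by (simp add: inst_def)

lemma eq_rep_eq_iff: "eq_rep S m = eq_rep S n \<longleftrightarrow> S \<turnstile> Eq m n"
proof
  assume *: "eq_rep S m = eq_rep S n"
  have "S \<turnstile> Eq k (eq_rep S k)" for k
    unfolding eq_rep_def by (rule LeastI) (rule proves.EqRefl)
  then show "S \<turnstile> Eq m n" using * by (metis proves_Eq_sym proves_Eq_trans)
next
  assume "S \<turnstile> Eq m n"
  then have "S \<turnstile> Eq m k \<longleftrightarrow> S \<turnstile> Eq n k" for k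
    by (metis proves_Eq_sym proves_Eq_trans)
  then show "eq_rep S m = eq_rep S n" by (simp add: eq_rep_def)
qed

text \<open>The renaming \<open>f\<close> is arbitrary because the quantifier case passes to
  \<open>case_nat t f\<close>.\<close>

lemma sat_term_model:
  assumes consistent: "\<not> S \<turnstile> Bot"
    and complete: "\<And>p. S \<turnstile> p \<or> S \<turnstile> Neg p"
    and henkin: "\<And>q. S \<turnstile> Neg (All q) \<Longrightarrow> \<exists>t. S \<turnstile> Neg (inst q t)"
  shows "sat (term_model S) (\<lambda>n. eq_rep S (f n)) p \<longleftrightarrow> S \<turnstile> rename f p"
proof (induction p arbitrary: f)
  case Bot
  then show ?case using consistent by simp
next
  case (Eq m n)
  then show ?case by (simp add: eq_rep_eq_iff)
next
  case (Le m n)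
  then show ?case
    by (auto simp: term_model_def eq_rep_eq_iff intro: proves_Le_cong proves_Eq_sym proves.EqRefl)
next
  case (Imp p q)
  have "S \<turnstile> Imp p q \<longleftrightarrow> (S \<turnstile> p \<longrightarrow> S \<turnstile> q)" for p q
  proof
    assume "S \<turnstile> p \<longrightarrow> S \<turnstile> q"
    then consider "S \<turnstile> q" | "S \<turnstile> Neg p" using complete by blast
    then show "S \<turnstile> Imp p q"
    proof cases
      case 1
      then show ?thesis by (meson proves.ImpI proves_weaken subset_insertI)
    next
      case 2
      then have "insert (Neg q) (insert p S) \<turnstile> Neg p" by (auto intro: proves_weaken)
      then have "insert (Neg q) (insert p S) \<turnstile> Bot"
        by (rule proves_NegE) (simp add: proves.Assm)
      then show ?thesis using proves.ImpI proves.Contr by blast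
    qed
  qed (blast intro: proves.ImpE)
  then show ?case using Imp by simp
next
  case (All p)
  have "sat (term_model S) (\<lambda>n. eq_rep S (f n)) (All p) \<longleftrightarrow>
      (\<forall>t. sat (term_model S) (case_nat (eq_rep S t) (\<lambda>n. eq_rep S (f n))) p)"
    by (simp add: term_model_def)
  also have "\<dots> \<longleftrightarrow> (\<forall>t. sat (term_model S) (\<lambda>n. eq_rep S (case_nat t f n)) p)"
  proof -
    have "case_nat (eq_rep S t) (\<lambda>n. eq_rep S (f n)) = (\<lambda>n. eq_rep S (case_nat t f n))" for t
      by (auto split: nat.split)
    then show ?thesis by simp
  qed
  also have "\<dots> \<longleftrightarrow> (\<forall>t. S \<turnstile> inst (rename (lift f) p) t)"
    using All by (simp add: inst_rename_lift)
  also have "\<dots> \<longleftrightarrow> S \<turnstile> rename f (All p)"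
  proof
    assume *: "\<forall>t. S \<turnstile> inst (rename (lift f) p) t"
    \<comment> \<open>Otherwise the Henkin property would refute some instance, although all
      instances are derivable.\<close>
    have "\<not> S \<turnstile> Neg (All (rename (lift f) p))"
      using * henkin consistent proves_NegE by blast
    then show "S \<turnstile> rename f (All p)" using complete by auto
  qed (auto intro: proves.AllE)
  finally show ?case .
qed

lemma is_struct_term_model: "is_struct (term_model S)"
  by (auto simp: is_struct_def term_model_def)

lemma sat_cong:
  assumes "sat X e p" "\<And>n. n \<in> fv p \<Longrightarrow> e n = e' n"
  shows "sat X e' p"
proof -
  have "sat X e p \<longleftrightarrow> sat X e' p"
    using assms(2)
  proof (induction p arbitrary: e e')
    case (All p)
    have "sat X (case_nat a e) p \<longleftrightarrow> sat X (case_nat a e') p" for a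
      by (rule All.IH) (use All.prems in \<open>auto split: nat.split\<close>)
    then show ?case by simp
  next
    case (Imp p q)
    then show ?case by (metis UnCI fv.simps(4) sat.simps(4))
  qed auto
  then show ?thesis using assms(1) by blast
qed

theorem model_existence:
  assumes T: "\<And>p. p \<in> T \<Longrightarrow> sentence p" "\<not> T \<turnstile> Bot"
  shows "\<exists>X :: nat struct. is_model X T"
proof -
  let ?S = "henkin_limit T"
  have consistent: "\<not> ?S \<turnstile> Bot" using henkin_limit_consistent T by blast
  have complete: "?S \<turnstile> p \<or> ?S \<turnstile> Neg p" for p
    by (rule henkin_limit_cases[of T p]) (auto intro: proves.Assm)
  have henkin: "\<exists>t. ?S \<turnstile> Neg (inst q t)" if "?S \<turnstile> Neg (All q)" for q
    by (rule henkin_limit_cases[of T "Neg (All q)"])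
      (use that consistent in \<open>auto intro: proves.Assm dest: proves_NegE\<close>)
  have "sat (term_model ?S) e p" if "p \<in> T" for p e
  proof -
    have "T \<subseteq> ?S" using henkin.simps(1) unfolding henkin_limit_def by blast
    then have "?S \<turnstile> rename (\<lambda>n. n) p" using that by (auto simp: rename_id intro: proves.Assm)
    then have "sat (term_model ?S) (\<lambda>n. eq_rep ?S n) p"
      using sat_term_model[OF consistent complete henkin, of "\<lambda>n. n"] by blast
    \<comment> \<open>The truth of a sentence does not depend on the environment, so the single
      environment \<open>eq_rep ?S\<close> settles every \<open>e\<close>.\<close>
    then show ?thesis
      using T(1)[OF that] by (auto simp: sentence_def intro: sat_cong)
  qed
  then have "is_model (term_model ?S) T"
    by (simp add: is_model_def is_struct_term_model)
  then show ?thesis by blast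
qed

section \<open>Copying models along injections\<close>

lemma sat_image:
  assumes "inj h"
  shows "sat (h ` fst X, map_prod h h ` snd X) (h \<circ> e) p \<longleftrightarrow> sat X e p"
proof (induction p arbitrary: e)
  case (All p)
  have "case_nat (h a) (h \<circ> e) = h \<circ> case_nat a e" for a
    by (rule ext) (simp split: nat.split)
  then show ?case by (simp only: sat.simps fst_conv ball_simps All)
next
  case (Le m n)
  show ?case
    using inj_image_mem_iff[OF prod.inj_map[OF assms assms], of "(e m, e n)" "snd X"] by simp
qed (use assms in \<open>auto simp: inj_eq\<close>)

lemma is_model_image:
  assumes "inj h" "is_model X T"
  shows "is_model (h ` fst X, map_prod h h ` snd X) T"
proof -
  have "sat (h ` fst X, map_prod h h ` snd X) e p" if "p \<in> T" "range e \<subseteq> h ` fst X" for p e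
  proof -
    have "\<exists>x. x \<in> fst X \<and> e n = h x" for n
      using that(2) by (meson image_iff range_subsetD)
    then obtain e' where e': "\<And>n. e' n \<in> fst X" "\<And>n. e n = h (e' n)" by metis
    have "sat X e' p"
      using e'(1) that(1) assms(2) by (simp add: is_model_def image_subset_iff)
    moreover have "e = h \<circ> e'" using e'(2) by (simp add: fun_eq_iff)
    ultimately show ?thesis by (simp only: sat_image[OF assms(1)])
  qed
  moreover have "is_struct (h ` fst X, map_prod h h ` snd X)"
    using assms(2) by (auto simp: is_model_def is_struct_def)
  ultimately show ?thesis by (simp add: is_model_def)
qed

lemma model_existence_infinite:
  assumes "\<And>p. p \<in> T \<Longrightarrow> sentence p" "\<not> T \<turnstile> Bot" "infinite (UNIV :: 'a set)"
  shows "\<exists>X :: 'a struct. is_model X T"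
proof -
  obtain X :: "nat struct" where "is_model X T" using model_existence assms(1,2) by blast
  moreover obtain h :: "nat \<Rightarrow> 'a" where "inj h"
    using assms(3) infinite_countable_subset by blast
  ultimately show ?thesis using is_model_image by blast
qed

section \<open>Decompositions in first-order terms\<close>

text \<open>
  If \<open>m i\<close> is the largest element of the part \<open>P i\<close>, then \<open>P i\<close> is recovered from \<open>m\<close>, because
  \<open>x \<le> m i\<close> says that \<open>x\<close> lies in some \<open>P k\<close> with \<open>k \<le> i\<close>.
\<close>

definition in_part :: "'a struct \<Rightarrow> 'i struct \<Rightarrow> ('i \<Rightarrow> 'a) \<Rightarrow> 'i \<Rightarrow> 'a \<Rightarrow> bool" where
  "in_part X I m i x \<longleftrightarrow>
     (x, m i) \<in> snd X \<and> (\<forall>j\<in>fst I. (j, i) \<in> snd I \<and> j \<noteq> i \<longrightarrow> (x, m j) \<notin> snd X)"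

text \<open>What \<open>m\<close> must satisfy for the recovered parts to form an FLD1
  decomposition: each maximum lies in its own part, the parts cover the domain without overlap, and
  the order is the lexicographic one. Quantifiers range only over elements of \<open>X\<close> and
  over the index set, which is finite in the applications.\<close>

definition part_maxima :: "'a struct \<Rightarrow> 'i struct \<Rightarrow> ('i \<Rightarrow> 'a) \<Rightarrow> bool" where
  "part_maxima X I m \<longleftrightarrow>
     (\<forall>i\<in>fst I. in_part X I m i (m i)) \<and>
     (\<forall>x\<in>fst X. \<exists>i\<in>fst I. in_part X I m i x) \<and>
     (\<forall>x\<in>fst X. \<forall>i\<in>fst I. \<forall>j\<in>fst I. in_part X I m i x \<and> in_part X I m j x \<longrightarrow> i = j) \<and>
     (\<forall>x\<in>fst X. \<forall>y\<in>fst X. (x, y) \<in> snd X \<longleftrightarrow>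
        (\<exists>i\<in>fst I. in_part X I m i x \<and> in_part X I m i y \<and> (x, y) \<in> snd X) \<or>
        (\<exists>i\<in>fst I. \<exists>j\<in>fst I. (i, j) \<in> snd I \<and> i \<noteq> j \<and> in_part X I m i x \<and> in_part X I m j y))"

lemma lex_sum_suborder_iff:
  "(x, y) \<in> snd (lex_sum I (\<lambda>i. suborder X (P i))) \<longleftrightarrow>
    (\<exists>i\<in>fst I. x \<in> P i \<and> y \<in> P i \<and> (x, y) \<in> snd X) \<or>
    (\<exists>i\<in>fst I. \<exists>j\<in>fst I. (i, j) \<in> snd I \<and> i \<noteq> j \<and> x \<in> P i \<and> y \<in> P j)"
  by (auto simp: lex_sum_def suborder_def)

lemma fld1_decomposition_part_maxima:
  assumes "fld1_decomposition X I P"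
  obtains m where "\<And>i. i \<in> fst I \<Longrightarrow> m i \<in> fst X" "part_maxima X I m"
proof -
  note d = assms[unfolded fld1_decomposition_def]
  have "\<forall>i\<in>fst I. \<exists>m. m \<in> P i \<and> (\<forall>x\<in>P i. (x, m) \<in> snd X)"
    using d by (auto simp: has_largest_def suborder_def)
  then obtain m where m: "\<And>i. i \<in> fst I \<Longrightarrow> m i \<in> P i"
    "\<And>i x. i \<in> fst I \<Longrightarrow> x \<in> P i \<Longrightarrow> (x, m i) \<in> snd X" by metis
  have disj: "i = j" if "i \<in> fst I" "j \<in> fst I" "x \<in> P i" "x \<in> P j" for i j x
    using that d by (auto simp: disjoint_family_on_def)
  have cover: "x \<in> fst X \<longleftrightarrow> (\<exists>i\<in>fst I. x \<in> P i)" for x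
    using d by blast
  have antisym: "antisym (snd I)" and refl: "\<And>i. i \<in> fst I \<Longrightarrow> (i, i) \<in> snd I"
    using d by (auto simp: is_po_def partial_order_on_def preorder_on_def refl_on_def)
  have lex: "X = lex_sum I (\<lambda>i. suborder X (P i))" using d by blast
  \<comment> \<open>Both \<open>lex\<close> and \<open>rel\<close> repeat their left-hand side on
    the right and would loop as rewrite rules; hence \<open>arg_cong\<close> here and
    \<open>subst\<close> below.\<close>
  have rel: "(x, y) \<in> snd X \<longleftrightarrow>
        (\<exists>i\<in>fst I. x \<in> P i \<and> y \<in> P i \<and> (x, y) \<in> snd X) \<or>
        (\<exists>i\<in>fst I. \<exists>j\<in>fst I. (i, j) \<in> snd I \<and> i \<noteq> j \<and> x \<in> P i \<and> y \<in> P j)" for x y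
    unfolding lex_sum_suborder_iff[symmetric]
    using lex by (rule arg_cong[where f = "\<lambda>Z. (x, y) \<in> snd Z"])
  \<comment> \<open>Comparison with a maximum reads off the index order: by the lexicographic clause
    if \<open>k\<close> differs from \<open>i\<close>, and because \<open>m i\<close> is largest in
    its part if \<open>k = i\<close>.\<close>
  have le_max: "(x, m i) \<in> snd X \<longleftrightarrow> (k, i) \<in> snd I"
    if "i \<in> fst I" "k \<in> fst I" "x \<in> P k" for x i k
  proof
    assume "(x, m i) \<in> snd X"
    then show "(k, i) \<in> snd I"
      using rel[of x "m i"] disj that m(1) refl by metis
  next
    assume "(k, i) \<in> snd I"
    then show "(x, m i) \<in> snd X"
      using rel[of x "m i"] that m by metis
  qed
  have part: "in_part X I m i x \<longleftrightarrow> x \<in> P i" if i: "i \<in> fst I" and x: "x \<in> fst X" for i x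
  proof -
    obtain k where k: "k \<in> fst I" "x \<in> P k" using x cover by blast
    \<comment> \<open>If \<open>k\<close> is strictly below \<open>i\<close>, then
      \<open>j = k\<close> violates the second clause of \<open>in_part\<close>. If
      \<open>k = i\<close>, then \<open>x\<close> below \<open>m j\<close> for some \<open>j\<close>
      strictly below \<open>i\<close> would contradict antisymmetry of the index order.\<close>
    have "in_part X I m i x \<longleftrightarrow> k = i"
      unfolding in_part_def using le_max[OF _ k] i k(1) refl antisym
      by (metis antisymD)
    then show ?thesis using k disj i by blast
  qed
  have mX: "m i \<in> fst X" if "i \<in> fst I" for i
    using that m(1) cover by blast
  have "part_maxima X I m"
    unfolding part_maxima_def
  proof (intro conjI ballI impI)
    fix x y assume xy: "x \<in> fst X" "y \<in> fst X"
    show "(x, y) \<in> snd X \<longleftrightarrow>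
        (\<exists>i\<in>fst I. in_part X I m i x \<and> in_part X I m i y \<and> (x, y) \<in> snd X) \<or>
        (\<exists>i\<in>fst I. \<exists>j\<in>fst I. (i, j) \<in> snd I \<and> i \<noteq> j \<and> in_part X I m i x \<and> in_part X I m j y)"
      by (subst rel) (simp add: part xy cong: bex_cong)
  next
    fix i assume "i \<in> fst I"
    then show "in_part X I m i (m i)" using mX m(1) part by simp
  next
    fix x assume "x \<in> fst X"
    then show "\<exists>i\<in>fst I. in_part X I m i x" using part cover by metis
  next
    fix x i j assume "x \<in> fst X" "i \<in> fst I" "j \<in> fst I"
      "in_part X I m i x \<and> in_part X I m j x"
    then show "i = j" using part disj by metis
  qed
  then show ?thesis using that mX by blast
qed

text \<open>The first clause of \<open>in_part\<close> makes \<open>m i\<close> an upper bound of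
  its part, and \<open>part_maxima\<close> puts \<open>m i\<close> into that part, so every part has
  a largest element.\<close>

lemma part_maxima_fld1_decomposition:
  assumes X: "is_struct X" and I: "is_po I" "finite (fst I)"
    and mX: "\<And>i. i \<in> fst I \<Longrightarrow> m i \<in> fst X" and m: "part_maxima X I m"
  shows "fld1_decomposition X I (\<lambda>i. {x\<in>fst X. in_part X I m i x})"
proof -
  let ?P = "\<lambda>i. {x\<in>fst X. in_part X I m i x}"
  note m = m[unfolded part_maxima_def]
  have "X = lex_sum I (\<lambda>i. suborder X (?P i))"
  proof (rule prod_eqI)
    show "fst X = fst (lex_sum I (\<lambda>i. suborder X (?P i)))"
      using m by (auto simp: lex_sum_def suborder_def)
    have rel: "(x, y) \<in> snd X \<longleftrightarrow>
        (\<exists>i\<in>fst I. x \<in> ?P i \<and> y \<in> ?P i \<and> (x, y) \<in> snd X) \<or>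
        (\<exists>i\<in>fst I. \<exists>j\<in>fst I. (i, j) \<in> snd I \<and> i \<noteq> j \<and> x \<in> ?P i \<and> y \<in> ?P j)" for x y
    proof (cases "x \<in> fst X \<and> y \<in> fst X")
      case True
      then have "(x, y) \<in> snd X \<longleftrightarrow>
        (\<exists>i\<in>fst I. in_part X I m i x \<and> in_part X I m i y \<and> (x, y) \<in> snd X) \<or>
        (\<exists>i\<in>fst I. \<exists>j\<in>fst I. (i, j) \<in> snd I \<and> i \<noteq> j \<and> in_part X I m i x \<and> in_part X I m j y)"
        using m by blast
      then show ?thesis using True by simp
    next
      \<comment> \<open>\<open>part_maxima\<close> speaks of domain elements only;
        \<open>is_struct\<close> excludes pairs outside the domain.\<close>
      case False
      then show ?thesis using X by (auto simp: is_struct_def)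
    qed
    show "snd X = snd (lex_sum I (\<lambda>i. suborder X (?P i)))"
      unfolding set_eq_iff split_paired_All lex_sum_suborder_iff by (intro allI) (rule rel)
  qed
  moreover have "disjoint_family_on ?P (fst I)"
    using m unfolding disjoint_family_on_def by blast
  moreover have "has_largest (suborder X (?P i))" if "i \<in> fst I" for i
    using that mX m by (auto simp: has_largest_def suborder_def in_part_def intro!: bexI[of _ "m i"])
  moreover have "(\<Union>i\<in>fst I. ?P i) = fst X" using m by blast
  moreover have "?P i \<noteq> {}" if "i \<in> fst I" for i
    using conjunct1[OF m] mX that by blast
  ultimately show ?thesis
    using I unfolding fld1_decomposition_def by (intro conjI ballI) simp_all
qed

text \<open>This trades a quantifier over families of sets for one over finitely many elements,
  which makes the property first-order.\<close>

lemma fld1_indices_iff: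
  assumes "is_struct X"
  shows "I \<in> fld1_indices X \<longleftrightarrow>
    is_po I \<and> finite (fst I) \<and> (\<exists>m. (\<forall>i\<in>fst I. m i \<in> fst X) \<and> part_maxima X I m)"
proof
  assume "I \<in> fld1_indices X"
  then obtain P where P: "fld1_decomposition X I P" by (auto simp: fld1_indices_def)
  then show "is_po I \<and> finite (fst I) \<and> (\<exists>m. (\<forall>i\<in>fst I. m i \<in> fst X) \<and> part_maxima X I m)"
    using fld1_decomposition_part_maxima[OF P] by (metis fld1_decomposition_def)
next
  assume "is_po I \<and> finite (fst I) \<and> (\<exists>m. (\<forall>i\<in>fst I. m i \<in> fst X) \<and> part_maxima X I m)"
  then show "I \<in> fld1_indices X"
    using part_maxima_fld1_decomposition[OF assms] unfolding fld1_indices_def by blast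
qed

section \<open>The sentence expressing a decomposition\<close>

definition And :: "fm \<Rightarrow> fm \<Rightarrow> fm" where
  "And p q = Neg (Imp p (Neg q))"

definition Or :: "fm \<Rightarrow> fm \<Rightarrow> fm" where
  "Or p q = Imp (Neg p) q"

definition Exists :: "fm \<Rightarrow> fm" where
  "Exists p = Neg (All (Neg p))"

definition Conj :: "fm list \<Rightarrow> fm" where
  "Conj ps = foldr And ps (Neg Bot)"

definition Disj :: "fm list \<Rightarrow> fm" where
  "Disj ps = foldr Or ps Bot"

lemma sat_connectives [simp]:
  "sat X e (And p q) \<longleftrightarrow> sat X e p \<and> sat X e q"
  "sat X e (Or p q) \<longleftrightarrow> sat X e p \<or> sat X e q"
  "sat X e (Exists p) \<longleftrightarrow> (\<exists>a\<in>fst X. sat X (case_nat a e) p)"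
  by (auto simp: And_def Or_def Exists_def)

lemma sat_Conj [simp]: "sat X e (Conj ps) \<longleftrightarrow> (\<forall>p\<in>set ps. sat X e p)"
  unfolding Conj_def by (induction ps) auto

lemma sat_Disj [simp]: "sat X e (Disj ps) \<longleftrightarrow> (\<exists>p\<in>set ps. sat X e p)"
  unfolding Disj_def by (induction ps) auto

lemma fv_connectives [simp]:
  "fv (Neg p) = fv p"
  "fv (And p q) = fv p \<union> fv q"
  "fv (Or p q) = fv p \<union> fv q"
  "fv (Exists p) = fv (All p)"
  by (auto simp: Neg_def And_def Or_def Exists_def)

lemma fv_Conj [simp]: "fv (Conj ps) = (\<Union>p\<in>set ps. fv p)"
  unfolding Conj_def by (induction ps) auto

lemma fv_Disj [simp]: "fv (Disj ps) = (\<Union>p\<in>set ps. fv p)"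
  unfolding Disj_def by (induction ps) auto

text \<open>The outermost of the \<open>n\<close> quantifiers binds variable \<open>n - 1\<close> of
  \<open>p\<close> and the innermost binds variable 0, so the variables of the outer environment
  start at \<open>n\<close>.\<close>

lemma sat_Exists_funpow:
  "sat X e ((Exists ^^ n) p) \<longleftrightarrow>
     (\<exists>c. (\<forall>k<n. c k \<in> fst X) \<and> sat X (\<lambda>k. if k < n then c k else e (k - n)) p)"
proof (induction n arbitrary: e)
  case 0
  then show ?case by simp
next
  case (Suc n)
  have "sat X e ((Exists ^^ Suc n) p) \<longleftrightarrow>
      (\<exists>a\<in>fst X. \<exists>c. (\<forall>k<n. c k \<in> fst X) \<and>
         sat X (\<lambda>k. if k < n then c k else case_nat a e (k - n)) p)"
    using Suc by simp
  also have "\<dots> \<longleftrightarrow> (\<exists>c. (\<forall>k<Suc n. c k \<in> fst X) \<and>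
      sat X (\<lambda>k. if k < Suc n then c k else e (k - Suc n)) p)" (is "?L \<longleftrightarrow> ?R")
  proof
    assume ?L
    then obtain a c where ac: "a \<in> fst X" "\<forall>k<n. c k \<in> fst X"
      "sat X (\<lambda>k. if k < n then c k else case_nat a e (k - n)) p" by blast
    have "(\<lambda>k. if k < n then c k else case_nat a e (k - n)) =
        (\<lambda>k. if k < Suc n then (c(n := a)) k else e (k - Suc n))"
      by (rule ext) (auto split: nat.split simp: less_Suc_eq diff_Suc)
    then show ?R using ac by (intro exI[of _ "c(n := a)"]) (auto simp: less_Suc_eq)
  next
    assume ?R
    then obtain c where c: "\<forall>k<Suc n. c k \<in> fst X"
      "sat X (\<lambda>k. if k < Suc n then c k else e (k - Suc n)) p" by blast
    have "(\<lambda>k. if k < n then c k else case_nat (c n) e (k - n)) =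
        (\<lambda>k. if k < Suc n then c k else e (k - Suc n))"
      by (rule ext) (auto split: nat.split simp: less_Suc_eq diff_Suc)
    then show ?L using c by (intro bexI[of _ "c n"] exI[of _ c]) auto
  qed
  finally show ?case .
qed

lemma fv_Exists_funpow: "fv ((Exists ^^ n) p) = {k. k + n \<in> fv p}"
  by (induction n) auto

text \<open>
  \<open>js\<close> lists the index order, and the variable \<open>v i\<close> stands for the largest element of part \<open>i\<close>.
\<close>

definition part_fm :: "'i rel \<Rightarrow> 'i list \<Rightarrow> ('i \<Rightarrow> nat) \<Rightarrow> 'i \<Rightarrow> nat \<Rightarrow> fm" where
  "part_fm r js v i x =
     And (Le x (v i)) (Conj [Neg (Le x (v j)). j \<leftarrow> js, (j, i) \<in> r \<and> j \<noteq> i])"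

text \<open>\<open>D1\<close> and \<open>D2\<close> move the maxima past one and two quantifiers. In
  the last conjunct variables 1 and 0 are the \<open>x\<close> and \<open>y\<close> of
  \<open>part_maxima\<close>.\<close>

definition part_maxima_fm :: "'i rel \<Rightarrow> 'i list \<Rightarrow> ('i \<Rightarrow> nat) \<Rightarrow> fm" where
  "part_maxima_fm r js v =
    (let D = part_fm r js v; D1 = part_fm r js (\<lambda>i. v i + 1); D2 = part_fm r js (\<lambda>i. v i + 2);
         R = Or (Disj [And (D2 i 1) (And (D2 i 0) (Le 1 0)). i \<leftarrow> js])
                (Disj [And (D2 i 1) (D2 j 0). i \<leftarrow> js, j \<leftarrow> js, (i, j) \<in> r \<and> i \<noteq> j])
     in Conj [Conj [D i (v i). i \<leftarrow> js],
              All (Disj [D1 i 0. i \<leftarrow> js]),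
              All (Conj [Neg (And (D1 i 0) (D1 j 0)). i \<leftarrow> js, j \<leftarrow> js, i \<noteq> j]),
              All (All (And (Imp (Le 1 0) R) (Imp R (Le 1 0))))])"

lemma sat_part_fm:
  "sat X e (part_fm r js v i x) \<longleftrightarrow> in_part X (set js, r) (\<lambda>i. e (v i)) i (e x)"
  by (auto simp: part_fm_def in_part_def)

lemma sat_part_maxima_fm:
  "sat X e (part_maxima_fm r js v) \<longleftrightarrow> part_maxima X (set js, r) (\<lambda>i. e (v i))"
  unfolding part_maxima_fm_def part_maxima_def Let_def
  by (simp add: sat_part_fm) (intro conj_cong ball_cong refl; blast)

lemma fv_part_fm: "i \<in> set js \<Longrightarrow> fv (part_fm r js v i x) \<subseteq> insert x (v ` set js)"
  by (auto simp: part_fm_def)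

lemma fv_part_maxima_fm: "fv (part_maxima_fm r js v) \<subseteq> v ` set js"
  unfolding part_maxima_fm_def Let_def
  by (auto dest!: subsetD[OF fv_part_fm, rotated])

lemma part_maxima_cong:
  assumes "\<And>i. i \<in> fst I \<Longrightarrow> m i = m' i"
  shows "part_maxima X I m \<longleftrightarrow> part_maxima X I m'"
proof -
  have "in_part X I m i x \<longleftrightarrow> in_part X I m' i x" if "i \<in> fst I" for i x
    using assms that by (simp add: in_part_def)
  then show ?thesis
    using assms by (simp add: part_maxima_def cong: bex_cong ball_cong)
qed

text \<open>The bijection \<open>v\<close> matches choices of maxima with values of the quantified
  variables: \<open>c\<close> yields \<open>c \<circ> v\<close>, and \<open>m\<close> yields
  \<open>m\<close> composed with the inverse of \<open>v\<close>. Values off the index set do not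
  matter, by \<open>part_maxima_cong\<close>.\<close>

lemma sat_decomposition_sentence:
  assumes X: "is_struct X" and I: "is_po I" "finite (fst I)"
    and js: "set js = fst I" and v: "bij_betw v (fst I) {..<n}"
  shows "sat X e ((Exists ^^ n) (part_maxima_fm (snd I) js v)) \<longleftrightarrow> I \<in> fld1_indices X"
proof -
  have v_less: "v i < n" if "i \<in> fst I" for i
    using that v by (auto simp: bij_betw_def)
  have "sat X (\<lambda>k. if k < n then c k else e (k - n)) (part_maxima_fm (snd I) js v) \<longleftrightarrow>
      part_maxima X I (c \<circ> v)" for c
    unfolding sat_part_maxima_fm js prod.collapse
    by (rule part_maxima_cong) (simp add: v_less)
  then have "sat X e ((Exists ^^ n) (part_maxima_fm (snd I) js v)) \<longleftrightarrow>
      (\<exists>c. (\<forall>k<n. c k \<in> fst X) \<and> part_maxima X I (c \<circ> v))"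
    by (simp add: sat_Exists_funpow)
  also have "\<dots> \<longleftrightarrow> (\<exists>m. (\<forall>i\<in>fst I. m i \<in> fst X) \<and> part_maxima X I m)"
  proof
    assume "\<exists>c. (\<forall>k<n. c k \<in> fst X) \<and> part_maxima X I (c \<circ> v)"
    then obtain c where "\<forall>k<n. c k \<in> fst X" "part_maxima X I (c \<circ> v)" by blast
    then show "\<exists>m. (\<forall>i\<in>fst I. m i \<in> fst X) \<and> part_maxima X I m"
      using v_less by (intro exI[of _ "c \<circ> v"]) simp
  next
    assume "\<exists>m. (\<forall>i\<in>fst I. m i \<in> fst X) \<and> part_maxima X I m"
    then obtain m where m: "\<forall>i\<in>fst I. m i \<in> fst X" "part_maxima X I m" by blast
    define c where "c = m \<circ> inv_into (fst I) v"
    have "c k \<in> fst X" if "k < n" for k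
      using that m(1) v by (auto simp: c_def bij_betw_def inv_into_into)
    moreover have "part_maxima X I (c \<circ> v)"
      using m(2) part_maxima_cong[of I "c \<circ> v" m X] v
      by (simp add: c_def bij_betw_def)
    ultimately show "\<exists>c. (\<forall>k<n. c k \<in> fst X) \<and> part_maxima X I (c \<circ> v)" by blast
  qed
  finally show ?thesis using fld1_indices_iff[OF X] I by blast
qed

lemma sentence_decomposition:
  assumes "v ` set js \<subseteq> {..<n}"
  shows "sentence ((Exists ^^ n) (part_maxima_fm r js v))"
proof -
  have "k + n \<notin> fv (part_maxima_fm r js v)" for k
    using subset_trans[OF fv_part_maxima_fm assms] by (meson lessThan_iff not_add_less2 subsetD)
  then show ?thesis by (simp add: sentence_def fv_Exists_funpow)
qed

section \<open>Models of a complete theory\<close>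

lemma complete_theory_sat_iff:
  assumes "complete_theory T" "sentence p" "is_model X T" "is_model Y T"
    "range e \<subseteq> fst X" "range e' \<subseteq> fst Y"
  shows "sat X e p \<longleftrightarrow> sat Y e' p"
proof -
  from assms(1,2) consider "T \<turnstile> p" | "T \<turnstile> Neg p" by (auto simp: complete_theory_def)
  then show ?thesis
    using soundness_model[OF _ assms(3,5)] soundness_model[OF _ assms(4,6)]
    by cases (blast, fastforce)
qed

lemma complete_theory_fld1_indices:
  fixes X :: "'a struct" and Y :: "'b struct"
  assumes "complete_theory T" "is_model X T" "is_model Y T"
  shows "(fld1_indices X :: 'i struct set) = fld1_indices Y"
proof -
  have str: "is_struct X" "is_struct Y" using assms by (auto simp: is_model_def)
  then obtain x y where xy: "x \<in> fst X" "y \<in> fst Y" by (auto simp: is_struct_def)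
  have "I \<in> fld1_indices X \<longleftrightarrow> I \<in> fld1_indices Y" if I: "is_po I" "finite (fst I)"
    for I :: "'i struct"
  proof -
    obtain js where js: "set js = fst I" using I(2) finite_list by blast
    obtain v where v: "bij_betw v (fst I) {..<card (fst I)}"
      using I(2) ex_bij_betw_finite_nat by (metis atLeast0LessThan)
    let ?p = "(Exists ^^ card (fst I)) (part_maxima_fm (snd I) js v)"
    have "sentence ?p" by (rule sentence_decomposition) (use v js in \<open>simp add: bij_betw_def\<close>)
    then have "sat X (\<lambda>_. x) ?p \<longleftrightarrow> sat Y (\<lambda>_. y) ?p"
      using complete_theory_sat_iff[OF assms(1) _ assms(2,3)] xy by auto
    then show ?thesis
      using sat_decomposition_sentence[OF str(1) I js v]
        sat_decomposition_sentence[OF str(2) I js v] by simp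
  qed
  \<comment> \<open>Index structures that are infinite or not partial orders lie in neither
    class.\<close>
  then show ?thesis
    using fld1_indices_iff[OF str(1)] fld1_indices_iff[OF str(2)] by blast
qed

lemma is_po_model:
  assumes "complete_po_theory T" "is_model X T"
  shows "is_po X"
proof -
  have X: "is_struct X" using assms by (simp add: is_model_def)
  then obtain x where x: "x \<in> fst X" by (auto simp: is_struct_def)
  have "\<forall>p\<in>po_axioms. sat X (\<lambda>_. x) p"
    using assms x soundness_model[of T _ X "\<lambda>_. x"] by (simp add: complete_po_theory_def)
  \<comment> \<open>Rewriting the numeral \<open>2\<close> as \<open>Suc (Suc 0)\<close> lets
    \<open>case_nat\<close> evaluate in the transitivity axiom.\<close>
  note ax = this[unfolded po_axioms_def, simplified, unfolded numeral_2_eq_2, simplified]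
  have refl: "\<forall>x\<in>fst X. (x, x) \<in> snd X"
    using ax by (elim conjE)
  have antisym: "\<forall>x\<in>fst X. \<forall>y\<in>fst X. (y, x) \<in> snd X \<longrightarrow> (x, y) \<in> snd X \<longrightarrow> y = x"
    using ax by (elim conjE)
  have trans: "\<forall>z\<in>fst X. \<forall>y\<in>fst X. \<forall>x\<in>fst X. (x, y) \<in> snd X \<longrightarrow> (y, z) \<in> snd X \<longrightarrow> (x, z) \<in> snd X"
    using ax by (elim conjE)
  have sub: "a \<in> fst X" "b \<in> fst X" if "(a, b) \<in> snd X" for a b
    using X that by (auto simp: is_struct_def)
  have "trans (snd X)" using trans sub by (meson transI)
  moreover have "antisym (snd X)" using antisym sub by (meson antisymI)
  ultimately show ?thesis
    using refl X
    by (simp add: is_po_def partial_order_on_def preorder_on_def refl_on_def is_struct_def)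
qed

lemma is_fld1_transfer:
  fixes X :: "'a struct" and Y :: "'b struct"
  assumes "complete_po_theory T" "is_model X T" "is_fld1 X" "is_model Y T"
  shows "is_fld1 Y"
proof -
  have "(fld1_indices X :: nat struct set) \<noteq> {}"
    using assms(3) by (auto simp: is_fld1_def fld1_indices_def)
  then have "(fld1_indices Y :: nat struct set) \<noteq> {}"
    using complete_theory_fld1_indices[OF _ assms(2,4)] assms(1)
    by (auto simp: complete_po_theory_def)
  then show ?thesis
    using is_po_model[OF assms(1,4)] by (auto simp: is_fld1_def fld1_indices_def)
qed

theorem theorem3p2:
  fixes T :: "fm set"
  assumes "complete_po_theory T"
  shows "(\<forall>X :: 'a struct. is_model X T \<and> is_fld1 X \<longrightarrow>
            (\<forall>Y :: 'b struct. is_model Y T \<longrightarrow>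
               (fld1_indices Y :: 'i struct set) = fld1_indices X)) \<and>
         (infinite (UNIV :: 'a set) \<and> infinite (UNIV :: 'b set) \<longrightarrow>
            ((\<exists>X :: 'a struct. is_model X T \<and> is_fld1 X) \<longleftrightarrow>
             (\<forall>Y :: 'b struct. is_model Y T \<longrightarrow> is_fld1 Y)))"
proof (intro conjI impI allI)
  fix X :: "'a struct" and Y :: "'b struct"
  assume "is_model X T \<and> is_fld1 X" "is_model Y T"
  then show "(fld1_indices Y :: 'i struct set) = fld1_indices X"
    using complete_theory_fld1_indices[of T Y X] assms by (simp add: complete_po_theory_def)
next
  assume inf: "infinite (UNIV :: 'a set) \<and> infinite (UNIV :: 'b set)"
  have T: "\<And>p. p \<in> T \<Longrightarrow> sentence p" "\<not> T \<turnstile> Bot"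
    using assms by (auto simp: complete_po_theory_def complete_theory_def)
  obtain M :: "'a struct" where M: "is_model M T"
    using model_existence_infinite[OF T] inf by blast
  obtain N :: "'b struct" where N: "is_model N T"
    using model_existence_infinite[OF T] inf by blast
  show "(\<exists>X :: 'a struct. is_model X T \<and> is_fld1 X) \<longleftrightarrow>
      (\<forall>Y :: 'b struct. is_model Y T \<longrightarrow> is_fld1 Y)"
  proof
    assume "\<exists>X :: 'a struct. is_model X T \<and> is_fld1 X"
    then show "\<forall>Y :: 'b struct. is_model Y T \<longrightarrow> is_fld1 Y"
      using is_fld1_transfer[OF assms] by blast
  next
    assume "\<forall>Y :: 'b struct. is_model Y T \<longrightarrow> is_fld1 Y"
    then have "is_fld1 N" using N by blast
    then have "is_fld1 M" using is_fld1_transfer[OF assms N _ M] by blast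
    then show "\<exists>X :: 'a struct. is_model X T \<and> is_fld1 X" using M by blast
  qed
qed

end
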